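(* Let $m\geq n \geq 4$ be integers and let $\gamma$ be a full $n$-Frenet helix in the unit Euclidean sphere $\mathbb{S}^m$. Then $\gamma$ is not triharmonic (i.e. not $3$-harmonic).
   Context: $\mathbb{S}^m$ is the unit sphere (constant curvature $1$), oriented, with Levi-Civita connection $\nabla$ and curvature $R(X,Y)Z=\langle Y,Z\rangle X-\langle X,Z\rangle Y$. Curves $\gamma:I\to \mathbb{S}^m$ ($I\subset\mathbb{R}$ an interval) are smooth and parametrized by arc length, with unit tangent $T=\gamma'$. Put $\nabla^0_TT=T$, $\nabla_T^kT=\nabla_T(\nabla_T^{k-1}T)$. For an integer $r\ge2$, $\gamma$ is $r$-harmonic if \[ \tau_r(\gamma)=\nabla^{2r-1}_T T+ \sum_{\ell=0}^{r-2}(-1)^\ell R\left (\nabla^{2r-3-\ell}_T T ,\nabla^{\ell}_T T\right )T=0; \] triharmonic means $3$-harmonic. For $2\le n\le m$, $\gamma$ is an $n$-Frenet helix if it admits an orthonormal field $\{F_1,\dots,F_n\}$ along $\gamma$ with $F_1=T$, $\nabla_TF_1=\kappa_1F_2$, $\nabla_TF_i=-\kappa_{i-1}F_{i-1}+\kappa_iF_{i+1}$ for $2\le i\le n-1$, $\nabla_TF_n=-\kappa_{n-1}F_{n-1}$, where $\kappa_1,\dots,\kappa_{n-1}$ are positive constants; in the special case $n=m$ the frame is instead chosen positively oriented and $\kappa_{n-1}$ is allowed to be any real constant. It is full if $\kappa_{n-1}\ne0$. *)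

theory Defs
  imports "HOL-Analysis.Analysis"
begin

text \<open>
  The sphere of dimension \<open>m\<close> is \<open>sphere 0 1\<close> in \<open>real ^ 'k\<close> with \<open>CARD('k) = m + 1\<close>.
  A curve defined on an interval \<open>I\<close> is a function on the reals of which only the values on \<open>I\<close>
  matter: all derivatives are taken within \<open>I\<close>, hence are one-sided at endpoints belonging to \<open>I\<close>.
\<close>

primrec nth_vderiv :: "real set \<Rightarrow> nat \<Rightarrow> (real \<Rightarrow> 'a::real_normed_vector) \<Rightarrow> real \<Rightarrow> 'a" where
  "nth_vderiv I 0 f = f"
| "nth_vderiv I (Suc k) f = (\<lambda>t. vector_derivative (nth_vderiv I k f) (at t within I))"

definition smooth_on :: "real set \<Rightarrow> (real \<Rightarrow> 'a::real_normed_vector) \<Rightarrow> bool" where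
  "smooth_on I f \<longleftrightarrow> (\<forall>k. nth_vderiv I k f differentiable_on I)"

definition velocity :: "real set \<Rightarrow> (real \<Rightarrow> 'a::real_normed_vector) \<Rightarrow> real \<Rightarrow> 'a" where
  "velocity I \<gamma> t = vector_derivative \<gamma> (at t within I)"

definition unit_speed_sphere_curve :: "real set \<Rightarrow> (real \<Rightarrow> real ^ 'k) \<Rightarrow> bool" where
  "unit_speed_sphere_curve I \<gamma> \<longleftrightarrow>
     is_interval I \<and> interior I \<noteq> {} \<and> smooth_on I \<gamma> \<and>
     (\<forall>t\<in>I. \<gamma> t \<in> sphere 0 1 \<and> norm (velocity I \<gamma> t) = 1)"

definition tangent_field_along :: "real set \<Rightarrow> (real \<Rightarrow> real ^ 'k) \<Rightarrow> (real \<Rightarrow> real ^ 'k) \<Rightarrow> bool" where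
  "tangent_field_along I \<gamma> V \<longleftrightarrow> smooth_on I V \<and> (\<forall>t\<in>I. V t \<bullet> \<gamma> t = 0)"

text \<open>
  The Levi-Civita connection of the unit sphere along a curve \<open>\<gamma>\<close>: the orthogonal projection of the
  Euclidean derivative onto the tangent space at \<open>\<gamma> t\<close>, which is the orthogonal complement of \<open>\<gamma> t\<close>.
\<close>

definition cov_deriv ::
  "real set \<Rightarrow> (real \<Rightarrow> real ^ 'k) \<Rightarrow> (real \<Rightarrow> real ^ 'k) \<Rightarrow> real \<Rightarrow> real ^ 'k" where
  "cov_deriv I \<gamma> V t =
     vector_derivative V (at t within I) - (vector_derivative V (at t within I) \<bullet> \<gamma> t) *\<^sub>R \<gamma> t"

definition nabla_T :: "real set \<Rightarrow> (real \<Rightarrow> real ^ 'k) \<Rightarrow> nat \<Rightarrow> real \<Rightarrow> real ^ 'k" where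
  "nabla_T I \<gamma> k = (cov_deriv I \<gamma> ^^ k) (velocity I \<gamma>)"

definition sphere_curvature :: "real ^ 'k \<Rightarrow> real ^ 'k \<Rightarrow> real ^ 'k \<Rightarrow> real ^ 'k" where
  "sphere_curvature X Y Z = (Y \<bullet> Z) *\<^sub>R X - (X \<bullet> Z) *\<^sub>R Y"

text \<open>For \<open>r \<ge> 2\<close> the subtractions on natural numbers below are never truncated.\<close>

definition tension :: "nat \<Rightarrow> real set \<Rightarrow> (real \<Rightarrow> real ^ 'k) \<Rightarrow> real \<Rightarrow> real ^ 'k" where
  "tension r I \<gamma> t =
     nabla_T I \<gamma> (2 * r - 1) t +
     (\<Sum>l = 0..r - 2. (-1) ^ l *\<^sub>R
        sphere_curvature (nabla_T I \<gamma> (2 * r - 3 - l) t) (nabla_T I \<gamma> l t) (velocity I \<gamma> t))"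

definition r_harmonic :: "nat \<Rightarrow> real set \<Rightarrow> (real \<Rightarrow> real ^ 'k) \<Rightarrow> bool" where
  "r_harmonic r I \<gamma> \<longleftrightarrow> (\<forall>t\<in>I. tension r I \<gamma> t = 0)"

abbreviation triharmonic :: "real set \<Rightarrow> (real \<Rightarrow> real ^ 'k) \<Rightarrow> bool" where
  "triharmonic \<equiv> r_harmonic 3"

text \<open>
  The index type \<open>'k\<close> carries no order, so an orientation of \<open>real ^ 'k\<close> is given by an
  enumeration \<open>e\<close> of the coordinates: \<open>axis (e 0) 1, axis (e 1) 1, \<dots>\<close> is a positive basis.
  In the matrix below the vector \<open>b j\<close> is the row with index \<open>e j\<close>.  The sphere is oriented by the
  outward normal: tangent vectors \<open>F 1, \<dots>, F m\<close> at \<open>p\<close> form a positive basis iff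
  \<open>p, F 1, \<dots>, F m\<close> does.  Both orientations of the sphere arise in this way, by varying \<open>e\<close>.
\<close>

definition positive_basis :: "(nat \<Rightarrow> 'k::finite) \<Rightarrow> (nat \<Rightarrow> real ^ 'k) \<Rightarrow> bool" where
  "positive_basis e b \<longleftrightarrow> det (\<chi> i. b (inv_into {..<CARD('k)} e i)) > 0"

definition positive_frame_at ::
  "(nat \<Rightarrow> 'k::finite) \<Rightarrow> real ^ 'k \<Rightarrow> (nat \<Rightarrow> real ^ 'k) \<Rightarrow> bool" where
  "positive_frame_at e p F \<longleftrightarrow> positive_basis e (\<lambda>j. if j = 0 then p else F j)"

text \<open>
  The frames admitted for an \<open>n\<close>-Frenet helix with curvatures \<open>\<kappa>\<close>, for \<open>2 \<le> n \<le> m\<close>;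
  the case \<open>n = m\<close> appears as \<open>n + 1 = CARD('k)\<close>.
\<close>

definition helix_frame ::
  "(nat \<Rightarrow> 'k::finite) \<Rightarrow> nat \<Rightarrow> real set \<Rightarrow> (real \<Rightarrow> real ^ 'k) \<Rightarrow>
   (nat \<Rightarrow> real \<Rightarrow> real ^ 'k) \<Rightarrow> (nat \<Rightarrow> real) \<Rightarrow> bool" where
  "helix_frame e n I \<gamma> F \<kappa> \<longleftrightarrow>
     (\<forall>i\<in>{1..n}. tangent_field_along I \<gamma> (F i)) \<and>
     (\<forall>t\<in>I. \<forall>i\<in>{1..n}. \<forall>j\<in>{1..n}. F i t \<bullet> F j t = (if i = j then 1 else 0)) \<and>
     (\<forall>t\<in>I. F 1 t = velocity I \<gamma> t) \<and>
     (\<forall>t\<in>I. cov_deriv I \<gamma> (F 1) t = \<kappa> 1 *\<^sub>R F 2 t) \<and>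
     (\<forall>t\<in>I. \<forall>i\<in>{2..n - 1}.
        cov_deriv I \<gamma> (F i) t = - \<kappa> (i - 1) *\<^sub>R F (i - 1) t + \<kappa> i *\<^sub>R F (i + 1) t) \<and>
     (\<forall>t\<in>I. cov_deriv I \<gamma> (F n) t = - \<kappa> (n - 1) *\<^sub>R F (n - 1) t) \<and>
     (\<forall>i\<in>{1..<n - 1}. \<kappa> i > 0) \<and>
     (if n + 1 = CARD('k) then \<forall>t\<in>I. positive_frame_at e (\<gamma> t) (\<lambda>i. F i t)
      else \<kappa> (n - 1) > 0)"

definition full_frenet_helix ::
  "(nat \<Rightarrow> 'k::finite) \<Rightarrow> nat \<Rightarrow> real set \<Rightarrow> (real \<Rightarrow> real ^ 'k) \<Rightarrow> bool" where
  "full_frenet_helix e n I \<gamma> \<longleftrightarrow> (\<exists>F \<kappa>. helix_frame e n I \<gamma> F \<kappa> \<and> \<kappa> (n - 1) \<noteq> 0)"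

end

theory Submission
  imports Defs
begin

text \<open>
  Write \<open>a, b, c, d\<close> for the squares of \<open>\<kappa>\<^sub>1, \<dots>, \<kappa>\<^sub>4\<close>, with \<open>d = 0\<close> when \<open>n = 4\<close>.  Expanding the 3-tension
  field by the Frenet equations, its \<open>F\<^sub>2\<close>- and \<open>F\<^sub>4\<close>-components vanish iff
  \<open>(a + b)\<^sup>2 + b c = 2 a + b\<close> and \<open>a + b + c + d = 1\<close>.  By the second equation \<open>c \<le> 1 - a - b\<close>,
  so the left-hand side of the first is at most \<open>a (a + b) + b < 2 a + b\<close>.
\<close>

text \<open>A connected set with more than one point has no isolated points. This makes derivatives
  within \<open>I\<close> unique, also at endpoints belonging to \<open>I\<close>.\<close>

lemma not_trivial_limit_within_interval:
  fixes I :: "real set"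
  assumes "is_interval I" "interior I \<noteq> {}" "t \<in> I"
  shows "at t within I \<noteq> bot"
proof -
  have "I \<noteq> {t}"
    using assms(2) by auto
  then have "t islimpt I"
    using assms(1,3) connected_imp_perfect is_interval_connected by blast
  then show ?thesis
    by (simp add: trivial_limit_within)
qed

lemma smooth_on_imp_differentiable_on: "smooth_on I f \<Longrightarrow> f differentiable_on I"
  unfolding smooth_on_def by (metis nth_vderiv.simps(1))

text \<open>Derivatives within \<open>I\<close> see only values on \<open>I\<close>, so
  \<open>eq\<close> is asked for on \<open>I\<close> alone, where the Frenet equations hold. Three
  summands are what the fourth derivative of the tangent takes; shorter combinations are padded with
  coefficient \<open>0\<close>.\<close>

lemma cov_deriv_lincomb:
  assumes "is_interval I" "interior I \<noteq> {}" "t \<in> I"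
    and eq: "\<And>s. s \<in> I \<Longrightarrow> X s = a *\<^sub>R U s + b *\<^sub>R V s + c *\<^sub>R W s"
    and "U differentiable_on I" "V differentiable_on I" "W differentiable_on I"
  shows "cov_deriv I \<gamma> X t
    = a *\<^sub>R cov_deriv I \<gamma> U t + b *\<^sub>R cov_deriv I \<gamma> V t + c *\<^sub>R cov_deriv I \<gamma> W t"
proof -
  let ?D = "\<lambda>f. vector_derivative f (at t within I)"
  have D: "(f has_vector_derivative ?D f) (at t within I)" if "f differentiable_on I"
    for f :: "real \<Rightarrow> real ^ 'b"
    using that assms(3) by (simp add: differentiable_on_def vector_derivative_works)
  have "((\<lambda>s. a *\<^sub>R U s + b *\<^sub>R V s + c *\<^sub>R W s) has_vector_derivative
      a *\<^sub>R ?D U + b *\<^sub>R ?D V + c *\<^sub>R ?D W) (at t within I)"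
    using assms(5-7)[THEN D] by (auto intro!: derivative_eq_intros)
  then have "(X has_vector_derivative a *\<^sub>R ?D U + b *\<^sub>R ?D V + c *\<^sub>R ?D W) (at t within I)"
    by (rule has_vector_derivative_transform[OF assms(3), rotated]) (simp add: eq)
  then have "?D X = a *\<^sub>R ?D U + b *\<^sub>R ?D V + c *\<^sub>R ?D W"
    using not_trivial_limit_within_interval[OF assms(1-3)] by (rule vector_derivative_within[rotated])
  then show ?thesis
    by (simp add: cov_deriv_def algebra_simps)
qed

lemma nabla_T_0: "nabla_T I \<gamma> 0 = velocity I \<gamma>"
  by (simp add: nabla_T_def)

lemma nabla_T_Suc: "nabla_T I \<gamma> (Suc k) = cov_deriv I \<gamma> (nabla_T I \<gamma> k)"
  by (simp add: nabla_T_def)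

lemma tension_3:
  "tension 3 I \<gamma> t = nabla_T I \<gamma> 5 t
     + sphere_curvature (nabla_T I \<gamma> 3 t) (nabla_T I \<gamma> 0 t) (nabla_T I \<gamma> 0 t)
     - sphere_curvature (nabla_T I \<gamma> 2 t) (nabla_T I \<gamma> 1 t) (nabla_T I \<gamma> 0 t)"
  by (simp add: tension_def nabla_T_0)

text \<open>
  In \<open>frenet_tension_components\<close>, \<open>V\<close> and \<open>W\<close> play the roles of \<open>F\<^sub>5\<close> and \<open>\<kappa>\<^sub>5 F\<^sub>6\<close>; they are \<open>0\<close> where
  the frame is too short, which treats \<open>n = 4\<close>, \<open>n = 5\<close> and \<open>n \<ge> 6\<close> alike.
\<close>

lemma frenet_tension_components:
  fixes F :: "nat \<Rightarrow> real \<Rightarrow> real ^ 'k"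
  assumes I: "is_interval I" "interior I \<noteq> {}"
    and diff: "\<And>i. i \<in> {1..4} \<Longrightarrow> F i differentiable_on I" "V differentiable_on I"
    and ortho: "\<And>t i j. t \<in> I \<Longrightarrow> i \<in> {1..4} \<Longrightarrow> j \<in> {1..4} \<Longrightarrow> F i t \<bullet> F j t = (if i = j then 1 else 0)"
    and W: "\<And>t. t \<in> I \<Longrightarrow> W t \<bullet> F 2 t = 0" "\<And>t. t \<in> I \<Longrightarrow> W t \<bullet> F 4 t = 0"
    and F1: "\<And>t. t \<in> I \<Longrightarrow> F 1 t = velocity I \<gamma> t"
    and frenet:
      "\<And>t. t \<in> I \<Longrightarrow> cov_deriv I \<gamma> (F 1) t = k1 *\<^sub>R F 2 t"
      "\<And>t. t \<in> I \<Longrightarrow> cov_deriv I \<gamma> (F 2) t = - k1 *\<^sub>R F 1 t + k2 *\<^sub>R F 3 t"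
      "\<And>t. t \<in> I \<Longrightarrow> cov_deriv I \<gamma> (F 3) t = - k2 *\<^sub>R F 2 t + k3 *\<^sub>R F 4 t"
      "\<And>t. t \<in> I \<Longrightarrow> cov_deriv I \<gamma> (F 4) t = - k3 *\<^sub>R F 3 t + k4 *\<^sub>R V t"
      "\<And>t. t \<in> I \<Longrightarrow> cov_deriv I \<gamma> V t = - k4 *\<^sub>R F 4 t + W t"
    and t: "t \<in> I"
  shows "tension 3 I \<gamma> t \<bullet> F 2 t = k1 * ((k1\<^sup>2 + k2\<^sup>2)\<^sup>2 + k2\<^sup>2 * k3\<^sup>2 - (2 * k1\<^sup>2 + k2\<^sup>2))"
    and "tension 3 I \<gamma> t \<bullet> F 4 t = k1 * k2 * k3 * (1 - (k1\<^sup>2 + k2\<^sup>2 + k3\<^sup>2 + k4\<^sup>2))"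
proof -
  note lin = cov_deriv_lincomb[OF I]
  have d: "F 1 differentiable_on I" "F 2 differentiable_on I" "F 3 differentiable_on I"
    "F 4 differentiable_on I"
    using diff(1) by simp_all
  \<comment> \<open>Each covariant derivative changes the parity of the frame index, with
    \<open>V\<close> counted as the fifth vector. So the third derivative involves only
    \<open>F 2\<close> and \<open>F 4\<close>; \<open>A\<close> and \<open>B\<close> are its
    coefficients, left folded until the final algebra.\<close>
  define A where "A = - k1 * (k1\<^sup>2 + k2\<^sup>2)"
  define B where "B = k1 * k2 * k3"
  have n0: "nabla_T I \<gamma> 0 s = F 1 s" if "s \<in> I" for s
    using F1 that by (simp add: nabla_T_0)
  \<comment> \<open>\<open>nabla_T I \<gamma> 0\<close> agrees with \<open>F 1\<close> only on
    \<open>I\<close>, so the derivative is transferred by the trivial combination with coefficients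
    \<open>1, 0, 0\<close>.\<close>
  have n1: "nabla_T I \<gamma> 1 s = k1 *\<^sub>R F 2 s" if "s \<in> I" for s
    using lin[OF that, of "nabla_T I \<gamma> 0" 1 "F 1" 0 "F 1" 0 "F 1"] n0 d frenet(1) that
    by (simp add: nabla_T_Suc)
  have n2: "nabla_T I \<gamma> 2 s = (- k1\<^sup>2) *\<^sub>R F 1 s + (k1 * k2) *\<^sub>R F 3 s" if "s \<in> I" for s
  proof -
    have "nabla_T I \<gamma> 2 s = cov_deriv I \<gamma> (nabla_T I \<gamma> 1) s"
      using nabla_T_Suc[of I \<gamma> 1] by (simp add: numeral_2_eq_2)
    also have "\<dots> = k1 *\<^sub>R (- k1 *\<^sub>R F 1 s + k2 *\<^sub>R F 3 s)"
      using lin[OF that, of "nabla_T I \<gamma> 1" k1 "F 2" 0 "F 2" 0 "F 2" \<gamma>] n1 d(2) frenet(2) that by simp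
    finally show ?thesis
      by (simp add: algebra_simps power2_eq_square)
  qed
  have n3: "nabla_T I \<gamma> 3 s = A *\<^sub>R F 2 s + B *\<^sub>R F 4 s" if "s \<in> I" for s
  proof -
    have "nabla_T I \<gamma> 3 s = cov_deriv I \<gamma> (nabla_T I \<gamma> 2) s"
      using nabla_T_Suc[of I \<gamma> 2] by simp
    also have "\<dots> = (- k1\<^sup>2) *\<^sub>R (k1 *\<^sub>R F 2 s) + (k1 * k2) *\<^sub>R (- k2 *\<^sub>R F 2 s + k3 *\<^sub>R F 4 s)"
      using lin[OF that, of "nabla_T I \<gamma> 2" "- k1\<^sup>2" "F 1" "k1 * k2" "F 3" 0 "F 1" \<gamma>]
        n2 d frenet(1,3) that by simp
    also have "\<dots> = A *\<^sub>R F 2 s + B *\<^sub>R F 4 s"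
      by (simp add: A_def B_def algebra_simps power2_eq_square)
    finally show ?thesis .
  qed
  have n4: "nabla_T I \<gamma> 4 s = (- A * k1) *\<^sub>R F 1 s + (A * k2 - B * k3) *\<^sub>R F 3 s + (B * k4) *\<^sub>R V s"
    if "s \<in> I" for s
  proof -
    have "nabla_T I \<gamma> 4 s = cov_deriv I \<gamma> (nabla_T I \<gamma> 3) s"
      using nabla_T_Suc[of I \<gamma> 3] by simp
    also have "\<dots> = A *\<^sub>R (- k1 *\<^sub>R F 1 s + k2 *\<^sub>R F 3 s) + B *\<^sub>R (- k3 *\<^sub>R F 3 s + k4 *\<^sub>R V s)"
      using lin[OF that, of "nabla_T I \<gamma> 3" A "F 2" B "F 4" 0 "F 1" \<gamma>] n3 d frenet(2,4) that by simp
    finally show ?thesis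
      by (simp add: algebra_simps)
  qed
  have "nabla_T I \<gamma> 5 t = cov_deriv I \<gamma> (nabla_T I \<gamma> 4) t"
    using nabla_T_Suc[of I \<gamma> 4] by simp
  also have "\<dots> = (- A * k1) *\<^sub>R (k1 *\<^sub>R F 2 t) + (A * k2 - B * k3) *\<^sub>R (- k2 *\<^sub>R F 2 t + k3 *\<^sub>R F 4 t)
      + (B * k4) *\<^sub>R (- k4 *\<^sub>R F 4 t + W t)"
    using lin[OF t n4 d(1) d(3) diff(2), of \<gamma>] frenet(1,3,5) t by simp
  finally have n5: "nabla_T I \<gamma> 5 t = \<dots>" .
  \<comment> \<open>The third derivative is orthogonal to the unit tangent, so the first curvature
    term returns it unchanged. In the second, the first derivative is orthogonal to the tangent and
    the second derivative has tangential part \<open>- k1\<^sup>2\<close>, which leaves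
    \<open>k1 ^ 3\<close> times \<open>F 2\<close>. Deleting \<open>One_nat_def\<close> keeps the
    index \<open>1\<close> in the form used by the rewrite rules.\<close>
  have tens: "tension 3 I \<gamma> t = nabla_T I \<gamma> 5 t + (A *\<^sub>R F 2 t + B *\<^sub>R F 4 t) - k1 ^ 3 *\<^sub>R F 2 t"
    using t by (simp add: tension_3 n0 n1 n2 n3 sphere_curvature_def inner_add_left
        inner_diff_left ortho power2_eq_square power3_eq_cube del: One_nat_def)
  have "tension 3 I \<gamma> t \<bullet> F 2 t = - A * k1\<^sup>2 - (A * k2 - B * k3) * k2 + A - k1 ^ 3"
    using t by (simp add: tens n5 inner_add_left inner_diff_left ortho W power2_eq_square)
  also have "\<dots> = k1 * ((k1\<^sup>2 + k2\<^sup>2)\<^sup>2 + k2\<^sup>2 * k3\<^sup>2 - (2 * k1\<^sup>2 + k2\<^sup>2))"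
    by (simp add: A_def B_def power2_eq_square power3_eq_cube algebra_simps)
  finally show "tension 3 I \<gamma> t \<bullet> F 2 t = \<dots>" .
  have "tension 3 I \<gamma> t \<bullet> F 4 t = (A * k2 - B * k3) * k3 - B * k4\<^sup>2 + B"
    using t by (simp add: tens n5 inner_add_left inner_diff_left ortho W power2_eq_square)
  also have "\<dots> = k1 * k2 * k3 * (1 - (k1\<^sup>2 + k2\<^sup>2 + k3\<^sup>2 + k4\<^sup>2))"
    by (simp add: A_def B_def power2_eq_square power3_eq_cube algebra_simps)
  finally show "tension 3 I \<gamma> t \<bullet> F 4 t = \<dots>" .
qed

text \<open>The last Frenet equation has its own form, so the cases differ in whether it concerns
  \<open>F 4\<close>, \<open>F 5\<close> or a later vector. The choices of \<open>k4\<close>,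
  \<open>V\<close> and \<open>W\<close> absorb this difference.\<close>

lemma helix_frame_fifth_vector:
  assumes I: "is_interval I" "interior I \<noteq> {}"
    and helix: "helix_frame e n I \<gamma> F \<kappa>" and "n \<ge> 4"
  obtains k4 V W where "V differentiable_on I"
    "\<And>t. t \<in> I \<Longrightarrow> cov_deriv I \<gamma> (F 4) t = - \<kappa> 3 *\<^sub>R F 3 t + k4 *\<^sub>R V t"
    "\<And>t. t \<in> I \<Longrightarrow> cov_deriv I \<gamma> V t = - k4 *\<^sub>R F 4 t + W t"
    "\<And>t. t \<in> I \<Longrightarrow> W t \<bullet> F 2 t = 0" "\<And>t. t \<in> I \<Longrightarrow> W t \<bullet> F 4 t = 0"
proof -
  have frenet: "cov_deriv I \<gamma> (F i) t = - \<kappa> (i - 1) *\<^sub>R F (i - 1) t + \<kappa> i *\<^sub>R F (i + 1) t"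
    if "t \<in> I" "i \<in> {2..n - 1}" for t i
    using helix that by (simp add: helix_frame_def)
  have last: "cov_deriv I \<gamma> (F n) t = - \<kappa> (n - 1) *\<^sub>R F (n - 1) t" if "t \<in> I" for t
    using helix that by (simp add: helix_frame_def)
  have ortho: "F i t \<bullet> F j t = (if i = j then 1 else 0)"
    if "t \<in> I" "i \<in> {1..n}" "j \<in> {1..n}" for t i j
    using helix that unfolding helix_frame_def by blast
  have F5: "F 5 differentiable_on I" if "n \<ge> 5"
    using helix that
    by (simp add: helix_frame_def tangent_field_along_def smooth_on_imp_differentiable_on)
  consider "n = 4" | "n = 5" | "n \<ge> 6"
    using \<open>n \<ge> 4\<close> by linarith
  then show thesis
  proof cases
    case 1
    \<comment> \<open>The zero field is the combination with all coefficients
      \<open>0\<close>.\<close>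
    have "cov_deriv I \<gamma> (\<lambda>_. 0) t = 0" if "t \<in> I" for t
      using cov_deriv_lincomb[OF I that, of "\<lambda>_. 0" 0 "\<lambda>_. 0" 0 "\<lambda>_. 0" 0 "\<lambda>_. 0" \<gamma>] by simp
    with 1 last show thesis
      by (intro that[of "\<lambda>_. 0" 0 "\<lambda>_. 0"]) simp_all
  next
    case 2
    show thesis
      by (rule that[of "F 5" "\<kappa> 4" "\<lambda>_. 0"])
        (use 2 last F5 frenet[of _ 4] in simp_all)
  next
    case 3
    show thesis
      by (rule that[of "F 5" "\<kappa> 4" "\<lambda>t. \<kappa> 5 *\<^sub>R F 6 t"])
        (use 3 F5 frenet[of _ 4] frenet[of _ 5] ortho in simp_all)
  qed
qed

theorem theorem5p1:
  fixes m n :: nat and e :: "nat \<Rightarrow> 'k::finite" and I :: "real set"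
    and \<gamma> :: "real \<Rightarrow> real ^ 'k"
  assumes "n \<ge> 4" and "m \<ge> n" and "CARD('k) = m + 1"
    and "bij_betw e {..m} UNIV"
    and "unit_speed_sphere_curve I \<gamma>"
    and "full_frenet_helix e n I \<gamma>"
  shows "\<not> triharmonic I \<gamma>"
proof
  assume "triharmonic I \<gamma>"
  have I: "is_interval I" "interior I \<noteq> {}"
    using assms(5) by (simp_all add: unit_speed_sphere_curve_def)
  \<comment> \<open>The curvatures are constant, so vanishing of the tension field at one parameter
    already yields the contradiction.\<close>
  then obtain t where t: "t \<in> I"
    using interior_subset by blast
  have tension: "tension 3 I \<gamma> t = 0"
    using \<open>triharmonic I \<gamma>\<close> t by (simp add: r_harmonic_def)
  obtain F \<kappa> where helix: "helix_frame e n I \<gamma> F \<kappa>" and full: "\<kappa> (n - 1) \<noteq> 0"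
    using assms(6) by (auto simp: full_frenet_helix_def)
  obtain k4 V W where VW: "V differentiable_on I"
    "\<And>t. t \<in> I \<Longrightarrow> cov_deriv I \<gamma> (F 4) t = - \<kappa> 3 *\<^sub>R F 3 t + k4 *\<^sub>R V t"
    "\<And>t. t \<in> I \<Longrightarrow> cov_deriv I \<gamma> V t = - k4 *\<^sub>R F 4 t + W t"
    "\<And>t. t \<in> I \<Longrightarrow> W t \<bullet> F 2 t = 0" "\<And>t. t \<in> I \<Longrightarrow> W t \<bullet> F 4 t = 0"
    by (rule helix_frame_fifth_vector[OF I helix assms(1)]) blast
  have pos: "\<kappa> i > 0" if "i \<in> {1..<n - 1}" for i
    using helix that unfolding helix_frame_def by blast
  \<comment> \<open>The frame gives positivity only below index \<open>n - 1\<close>. For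
    \<open>n = 4\<close> this misses \<open>\<kappa> 3\<close>, which may be negative if also
    \<open>m = 4\<close>; fullness then makes it nonzero, which is enough to cancel it and to have
    \<open>c > 0\<close>.\<close>
  have "\<kappa> 3 \<noteq> 0"
  proof (cases "n = 4")
    case True
    then show ?thesis
      using full by simp
  next
    case False
    then have "3 \<in> {1..<n - 1}"
      using assms(1) by auto
    then show ?thesis
      using pos[of 3] by simp
  qed
  moreover have "\<kappa> 1 > 0" "\<kappa> 2 > 0"
    using pos[of 1] pos[of 2] assms(1) by simp_all
  ultimately have \<kappa>: "\<kappa> 1 > 0" "\<kappa> 2 > 0" "\<kappa> 3 \<noteq> 0"
    by simp_all
  have diff: "F i differentiable_on I" if "i \<in> {1..4}" for i
    using helix that assms(1)
    by (simp add: helix_frame_def tangent_field_along_def smooth_on_imp_differentiable_on)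
  have ortho: "F i s \<bullet> F j s = (if i = j then 1 else 0)"
    if "s \<in> I" "i \<in> {1..4}" "j \<in> {1..4}" for s i j
  proof -
    have "i \<in> {1..n}" "j \<in> {1..n}"
      using that assms(1) by auto
    then show ?thesis
      using helix that(1) unfolding helix_frame_def by blast
  qed
  have F1: "F 1 s = velocity I \<gamma> s" "cov_deriv I \<gamma> (F 1) s = \<kappa> 1 *\<^sub>R F 2 s" if "s \<in> I" for s
    using helix that by (simp_all add: helix_frame_def)
  have frenet: "cov_deriv I \<gamma> (F i) s = - \<kappa> (i - 1) *\<^sub>R F (i - 1) s + \<kappa> i *\<^sub>R F (i + 1) s"
    if "s \<in> I" "i \<in> {2..n - 1}" for s i
    using helix that by (simp add: helix_frame_def)
  have frenet2: "cov_deriv I \<gamma> (F 2) s = - \<kappa> 1 *\<^sub>R F 1 s + \<kappa> 2 *\<^sub>R F 3 s" if "s \<in> I" for s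
    using frenet[OF that, of 2] assms(1) by simp
  have frenet3: "cov_deriv I \<gamma> (F 3) s = - \<kappa> 2 *\<^sub>R F 2 s + \<kappa> 3 *\<^sub>R F 4 s" if "s \<in> I" for s
    using frenet[OF that, of 3] assms(1) by simp
  note comp = frenet_tension_components[of I F V W \<gamma> "\<kappa> 1" "\<kappa> 2" "\<kappa> 3" k4 t,
      OF I diff VW(1) ortho VW(4,5) F1 frenet2 frenet3 VW(2,3) t]
  define a b c where "a = (\<kappa> 1)\<^sup>2" and "b = (\<kappa> 2)\<^sup>2" and "c = (\<kappa> 3)\<^sup>2"
  have abc: "a > 0" "b > 0" "c > 0"
    using \<kappa> by (simp_all add: a_def b_def c_def)
  have E2: "(a + b)\<^sup>2 + b * c = 2 * a + b"
    using comp(1) tension \<kappa> by (simp add: a_def b_def c_def)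
  have "a + b + c + k4\<^sup>2 = 1"
    using comp(2) tension \<kappa> by (simp add: a_def b_def c_def)
  \<comment> \<open>Discarding the square of \<open>k4\<close> leaves an inequality valid for every
    \<open>n\<close> at once.\<close>
  then have E4: "a + b + c \<le> 1"
    using zero_le_power2[of k4] by linarith
  have "b * c \<le> b * (1 - a - b)"
    using abc E4 by (intro mult_left_mono) auto
  \<comment> \<open>This uses \<open>(a + b)\<^sup>2 + b * (1 - a - b) = a * (a + b) + b\<close>. As
    \<open>a + b\<close> is at most \<open>1\<close>, it would follow that \<open>2 * a + b\<close>
    is at most \<open>a + b\<close>, against \<open>a > 0\<close>.\<close>
  then have "2 * a + b \<le> a * (a + b) + b"
    using E2 by (simp add: power2_eq_square algebra_simps)
  moreover have "a * (a + b) \<le> a * 1"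
    using abc E4 by (intro mult_left_mono) auto
  ultimately show False
    using abc by linarith
qed

end
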